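(* Let $n\ge 1$, $p\in(0,\infty]$, and let $q\in(0,1/n]$ be given by $\frac1q=\frac1p+n$. Let $w:\mathbb{R}^n\to\mathbb{R}_+=[0,\infty)$ be a measurable function which is both $p$-concave and $p$-homogeneous, and let $\mu=w(x)\,dx$. Let $\|\cdot\|_K$ be an arbitrary semi-norm on $\mathbb{R}^n$ with open unit ball $K=\{x:\|x\|_K<1\}$. Then for every Borel set $A\subset\mathbb{R}^n$ with $\mu(A)<\infty$, $$\mu^+_{\|\cdot\|_K}(A)\ \ge\ \frac1q\,\mu(K)^q\,\mu(A)^{1-q},$$ with equality for $A=tK$, $t>0$. In other words, homothetic copies of $K$ are isoperimetric minimizers for $(\mathbb{R}^n,\|\cdot\|_K,\mu)$.
   Context: Semi-norms need not be symmetric: a semi-norm is a subadditive function $\|\cdot\|:\mathbb{R}^n\to[0,\infty)$ with $\|\lambda x\|=\lambda\|x\|$ for all $\lambda\ge0$. $w:\mathbb{R}^n\to\mathbb{R}_+$ is $p$-concave if for all $x,y$ with $w(x)w(y)>0$ and all $\lambda\in(0,1)$, $w(\lambda x+(1-\lambda)y)\ge(\lambda w(x)^p+(1-\lambda)w(y)^p)^{1/p}$, where for $p=\infty$ the right-hand side means $\max(w(x),w(y))$. $w$ is $p$-homogeneous if $w(\lambda x)^p=\lambda w(x)^p$ for all $x\in\mathbb{R}^n$, $\lambda>0$; for $p=\infty$ this means $w(\lambda x)=w(x)$ for all $\lambda>0$. For $p=\infty$, $1/p=0$. Outer Minkowski boundary measure: $\mu^+_{\|\cdot\|_K}(A)=\liminf_{\epsilon\to0^+}\frac{\mu((A+\epsilon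 K)\setminus A)}{\epsilon}$, where $A+\epsilon K$ is the Minkowski sum. The equality assertion concerns sets $A=tK$ of finite $\mu$-measure. The right-hand side is interpreted as $0$ when $\mu(A)=0$. *)

theory Defs
  imports "HOL-Analysis.Analysis"
begin

text \<open>Semi-norms are finite and nonnegative, but need not be symmetric.\<close>

definition asym_seminorm :: "('a::real_vector \<Rightarrow> real) \<Rightarrow> bool" where
  "asym_seminorm N \<longleftrightarrow>
     (\<forall>x. 0 \<le> N x) \<and>
     (\<forall>x y. N (x + y) \<le> N x + N y) \<and>
     (\<forall>c\<ge>0. \<forall>x. N (c *\<^sub>R x) = c * N x)"

text \<open>
  The next two notions are meant for an exponent \<open>p\<close> in \<open>(0, \<infinity>]\<close>. For finite \<open>p\<close> the bases
  of \<open>powr\<close> below are nonnegative and its exponents positive, so it is the usual power,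
  including \<open>0 powr p = 0\<close>.
\<close>

definition p_concave :: "ereal \<Rightarrow> ('a::real_vector \<Rightarrow> real) \<Rightarrow> bool" where
  "p_concave p w \<longleftrightarrow>
     (\<forall>x y l. w x * w y > 0 \<and> 0 < l \<and> l < 1 \<longrightarrow>
        w (l *\<^sub>R x + (1 - l) *\<^sub>R y) \<ge>
          (if p = \<infinity> then max (w x) (w y)
           else (l * w x powr real_of_ereal p + (1 - l) * w y powr real_of_ereal p)
                  powr (1 / real_of_ereal p)))"

definition p_homogeneous :: "ereal \<Rightarrow> ('a::real_vector \<Rightarrow> real) \<Rightarrow> bool" where
  "p_homogeneous p w \<longleftrightarrow>
     (\<forall>x l. 0 < l \<longrightarrow>
        (if p = \<infinity> then w (l *\<^sub>R x) = w x
         else w (l *\<^sub>R x) powr real_of_ereal p = l * w x powr real_of_ereal p))"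

definition outer_boundary_measure :: "'a::real_vector measure \<Rightarrow> 'a set \<Rightarrow> 'a set \<Rightarrow> ennreal" where
  "outer_boundary_measure M K A =
     Liminf (at_right 0) (\<lambda>\<epsilon>::real. emeasure M ((A + ((*\<^sub>R) \<epsilon>) ` K) - A) / ennreal \<epsilon>)"

text \<open>Powers with real exponent \<open>r \<ge> 0\<close> on \<open>[0, \<infinity>]\<close>; note that \<open>0 powr 0 = 0\<close> for \<open>powr\<close> on the reals.\<close>

definition ennreal_powr :: "ennreal \<Rightarrow> real \<Rightarrow> ennreal" where
  "ennreal_powr x r =
     (if x = \<infinity> then (if r = 0 then 1 else \<infinity>) else ennreal (enn2real x powr r))"

text \<open>
  The value 0 for null sets \<open>A\<close> is part of the convention: it settles \<open>0 powr (1 - q)\<close> for \<open>q = 1\<close>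
  and the product of infinity and 0 when \<open>K\<close> has infinite measure.
\<close>

definition isoperimetric_bound :: "'a measure \<Rightarrow> 'a set \<Rightarrow> real \<Rightarrow> 'a set \<Rightarrow> ennreal" where
  "isoperimetric_bound M K q A =
     (if emeasure M A = 0 then 0
      else ennreal (1 / q) * ennreal_powr (emeasure M K) q * ennreal_powr (emeasure M A) (1 - q))"

text \<open>Only meant for sets \<open>A\<close> of finite measure; the competitors are the Borel sets of the same measure.\<close>

definition isoperimetric_minimizer :: "'a::euclidean_space measure \<Rightarrow> 'a set \<Rightarrow> 'a set \<Rightarrow> bool" where
  "isoperimetric_minimizer M K A \<longleftrightarrow>
     (\<forall>B\<in>sets borel. emeasure M B = emeasure M A \<longrightarrow>
        outer_boundary_measure M K A \<le> outer_boundary_measure M K B)"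

end

theory Submission
  imports Defs
begin

text \<open>
  With \<open>r = 1 / p\<close>, the weight satisfies \<open>w (x + y) \<ge> (w x powr p + w y powr p) powr (1 / p)\<close>
  wherever \<open>w x\<close> and \<open>w y\<close> are positive. An inequality of this kind for functions \<open>f, g, h\<close> passes
  to their integrals over the line with \<open>r\<close> replaced by \<open>r + 1\<close>: after scaling \<open>f\<close> and \<open>g\<close> by
  their suprema, compare superlevel sets by the Brunn-Minkowski inequality on the line and apply
  Hoelder's inequality. Integrating one coordinate at a time gives the exponent \<open>r + n = 1 / q\<close>, so
  \<open>\<mu>(A + \<epsilon>K)\<^sup>q \<ge> \<mu>(A)\<^sup>q + \<mu>(\<epsilon>K)\<^sup>q = \<mu>(A)\<^sup>q + \<epsilon> \<mu>(K)\<^sup>q\<close>,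
  the equality by homogeneity. Bernoulli's inequality turns this into the claimed lower bound for
  every \<open>\<epsilon>\<close>. For \<open>A = tK\<close>, \<open>A + \<epsilon>K = (t + \<epsilon>)K\<close> and the boundary measure is a derivative.
\<close>

text \<open>
  The parameter \<open>r\<close> is the reciprocal of the exponent, so that \<open>p = \<infinity>\<close> is \<open>r = 0\<close> and each
  integration adds one. Below, premises \<open>ennreal a \<le> f x\<close> with real \<open>a\<close> stand in for powers of
  extended values.
\<close>

definition power_sum :: "real \<Rightarrow> real \<Rightarrow> real \<Rightarrow> real" where
  "power_sum r a b = (if r = 0 then max a b else (a powr (1 / r) + b powr (1 / r)) powr r)"

section \<open>Algebra of two-term power sums\<close>

lemma power_sum_scale:
  assumes "0 \<le> r" "0 < c" "0 < a" "0 < b"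
  shows "power_sum r (c * a) (c * b) = c * power_sum r a b"
proof (cases "r = 0")
  case False
  have "(c * a) powr (1 / r) + (c * b) powr (1 / r) = c powr (1 / r) * (a powr (1 / r) + b powr (1 / r))"
    using assms by (simp add: powr_mult algebra_simps)
  then show ?thesis
    using False assms by (simp add: power_sum_def powr_mult powr_powr)
qed (use assms in \<open>simp add: power_sum_def max_mult_distrib_left\<close>)

lemma power_sum_pos: "0 < a \<Longrightarrow> 0 < b \<Longrightarrow> 0 < power_sum r a b"
  using add_pos_pos[of "a powr (1 / r)" "b powr (1 / r)"] by (auto simp: power_sum_def max_def)

lemma power_sum_mono:
  assumes "0 \<le> r" "0 < a" "0 < b" "a \<le> a'" "b \<le> b'"
  shows "power_sum r a b \<le> power_sum r a' b'"
proof (cases "r = 0")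
  case False
  then show ?thesis
    unfolding power_sum_def using assms by (auto intro!: powr_mono2 add_mono)
qed (use assms in \<open>auto simp: power_sum_def max_def\<close>)

text \<open>For \<open>r > 0\<close> this is Hoelder's inequality for two terms with conjugate
  exponents \<open>(r + 1) / r\<close> and \<open>r + 1\<close>. In its use \<open>m, k\<close> are
  suprema of two functions and \<open>u, v\<close> the integrals of the functions divided by them;
  it is the step that raises the exponent by one.\<close>

lemma power_sum_Suc_le:
  assumes r: "0 \<le> r" and pos: "0 < m" "0 < k" "0 < u" "0 < v"
  shows "power_sum (r + 1) (u * m) (v * k) \<le> power_sum r m k * (u + v)"
proof (cases "r = 0")
  case True
  have "u * m + v * k \<le> max m k * u + max m k * v"
    using pos by (intro add_mono) (simp_all add: mult.commute mult_right_mono)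
  then show ?thesis
    using True pos by (simp add: power_sum_def algebra_simps)
next
  case False
  then have rp: "0 < r" using r by simp
  define X where "X = m powr (1 / r) + k powr (1 / r)"
  define Y where "Y = u + v"
  define s where "s = r + 1"
  have XY: "0 < X" "0 < Y" and s: "0 < s" "s \<noteq> 0"
    using pos rp by (auto simp: X_def Y_def s_def add_pos_pos)
  \<comment> \<open>Young's inequality with weights \<open>r / s\<close> and \<open>1 / s\<close>,
    applied to a term divided by the totals \<open>X\<close> and \<open>Y\<close>. Summed over the
    two terms, the normalised fractions add up to one, so the bracket becomes
    \<open>r / s + 1 / s = 1\<close>.\<close>
  have *: "(y * z) powr (1 / s) \<le>
      (r / s * (z powr (1 / r) / X) + 1 / s * (y / Y)) * (X powr (r / s) * Y powr (1 / s))"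
    if "0 < y" "0 < z" for y z
  proof -
    have "(z powr (1 / r) / X) powr (r / s) * (y / Y) powr (1 / s) \<le>
        r / s * (z powr (1 / r) / X) + 1 / s * (y / Y)"
      using that XY rp by (intro Youngs_inequality_0) (auto simp: s_def field_simps)
    moreover have "(z powr (1 / r) / X) powr (r / s) * (y / Y) powr (1 / s) =
        (y * z) powr (1 / s) / (X powr (r / s) * Y powr (1 / s))"
      using that XY rp s by (simp add: powr_divide powr_powr powr_mult)
    ultimately show ?thesis
      using XY by (simp add: divide_le_eq)
  qed
  have "(u * m) powr (1 / s) + (v * k) powr (1 / s) \<le>
     (r / s * (m powr (1 / r) / X) + 1 / s * (u / Y)) * (X powr (r / s) * Y powr (1 / s)) +
     (r / s * (k powr (1 / r) / X) + 1 / s * (v / Y)) * (X powr (r / s) * Y powr (1 / s))"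
    using *[of u m] *[of v k] pos by simp
  also have "\<dots> = (r / s * ((m powr (1 / r) + k powr (1 / r)) / X) + 1 / s * ((u + v) / Y)) * (X powr (r / s) * Y powr (1 / s))"
    by (simp add: algebra_simps add_divide_distrib)
  also have "\<dots> = X powr (r / s) * Y powr (1 / s)"
    using XY s rp unfolding X_def[symmetric] Y_def[symmetric] by (simp add: s_def field_simps)
  finally have "((u * m) powr (1 / s) + (v * k) powr (1 / s)) powr s \<le> (X powr (r / s) * Y powr (1 / s)) powr s"
    using s by (intro powr_mono2) auto
  also have "\<dots> = X powr r * Y"
    using XY s by (simp add: powr_mult powr_powr)
  finally show ?thesis
    using rp by (simp add: power_sum_def s_def X_def Y_def add_pos_pos)
qed

section \<open>The Brunn-Minkowski inequality on the line\<close>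

text \<open>If \<open>b\<close> is almost the least point of \<open>B\<close> and \<open>a\<close>
  almost the greatest point of \<open>A\<close>, the translates \<open>A + b\<close> and
  \<open>B + a\<close> both lie in \<open>C\<close> and overlap in a short interval only. Taking a
  measurable superset \<open>C\<close> avoids the question whether the sumset itself is
  measurable.\<close>

lemma emeasure_sumset_real:
  fixes A B C :: "real set"
  assumes [measurable]: "A \<in> sets borel" "B \<in> sets borel" "C \<in> sets borel"
    and ne: "A \<noteq> {}" "B \<noteq> {}"
    and sub: "\<And>x y. x \<in> A \<Longrightarrow> y \<in> B \<Longrightarrow> x + y \<in> C"
  shows "emeasure lborel A + emeasure lborel B \<le> emeasure lborel C"
proof -
  have bdd: "emeasure lborel A' + emeasure lborel B' \<le> emeasure lborel C"
    if A': "A' \<subseteq> A" "A' \<noteq> {}" "bdd_above A'" and [measurable]: "A' \<in> sets borel"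
      and B': "B' \<subseteq> B" "B' \<noteq> {}" "bdd_below B'" and [measurable]: "B' \<in> sets borel" for A' B'
  proof (rule ennreal_le_epsilon)
    fix e :: real assume e: "0 < e"
    obtain a where a: "a \<in> A'" "Sup A' - e / 2 < a"
      using less_cSup_iff[OF A'(2,3), of "Sup A' - e / 2"] e by auto
    obtain b where b: "b \<in> B'" "b < Inf B' + e / 2"
      using cInf_less_iff[OF B'(2,3), of "Inf B' + e / 2"] e by auto
    \<comment> \<open>\<open>S\<close> is \<open>A' + b\<close> and \<open>T\<close> is
      \<open>B' + a\<close>. Both come within \<open>e / 2\<close> of \<open>a + b\<close>, one from
      the left and one from the right, so they meet in an interval of length at most
      \<open>e\<close>.\<close>
    define S where "S = (\<lambda>x. x - b) -` A'"
    define T where "T = (\<lambda>x. x - a) -` B'"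
    have [measurable]: "S \<in> sets borel" "T \<in> sets borel"
      unfolding S_def T_def by (auto intro!: measurable_sets_borel[where M=borel])
    have tr: "emeasure lborel ((\<lambda>x. x - c) -` D) = emeasure lborel D" if "D \<in> sets borel" for c and D :: "real set"
    proof -
      have "emeasure lborel D = emeasure (distr lborel borel ((+) (- c))) D"
        by (simp add: lborel_distr_plus)
      also have "\<dots> = emeasure lborel ((\<lambda>x. x - c) -` D)"
        using that by (subst emeasure_distr) (auto simp: vimage_def)
      finally show ?thesis by simp
    qed
    have ST: "emeasure lborel S = emeasure lborel A'" "emeasure lborel T = emeasure lborel B'"
      unfolding S_def T_def by (simp_all add: tr)
    have "S \<inter> T \<subseteq> {a + b - e / 2 .. a + b + e / 2}"
    proof
      fix x assume "x \<in> S \<inter> T"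
      then have "x - b \<in> A'" "x - a \<in> B'" by (auto simp: S_def T_def)
      then have "x - b \<le> Sup A'" "Inf B' \<le> x - a"
        using A' B' by (auto intro: cSup_upper cInf_lower)
      then show "x \<in> {a + b - e / 2 .. a + b + e / 2}" using a b by auto
    qed
    then have "emeasure lborel (S \<inter> T) \<le> emeasure lborel {a + b - e / 2 .. a + b + e / 2}"
      by (intro emeasure_mono) auto
    also have "\<dots> = ennreal e" using e by simp
    finally have small: "emeasure lborel (S \<inter> T) \<le> ennreal e" .
    have "S \<union> T \<subseteq> C"
    proof
      fix x assume "x \<in> S \<union> T"
      then have "x - b \<in> A \<or> x - a \<in> B" using A' B' by (auto simp: S_def T_def)
      then show "x \<in> C"
        using sub[of "x - b" b] sub[of a "x - a"] a b A' B' by auto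
    qed
    then have "emeasure lborel (S \<union> T) \<le> emeasure lborel C"
      by (intro emeasure_mono) auto
    then show "emeasure lborel A' + emeasure lborel B' \<le> emeasure lborel C + ennreal e"
      using emeasure_Un_Int[of S lborel T] small ST by (simp add: add_mono)
  qed
  obtain a b where ab: "a \<in> A" "b \<in> B" using ne by auto
  \<comment> \<open>Truncating \<open>A\<close> from above and \<open>B\<close> from below supplies
    the supremum and infimum; \<open>a\<close> and \<open>b\<close> stay in every truncation, which
    keeps them nonempty.\<close>
  define An where "An n = A \<inter> {.. a + real n}" for n
  define Bn where "Bn n = B \<inter> {b - real n ..}" for n
  have [measurable]: "An n \<in> sets borel" "Bn n \<in> sets borel" for n
    by (auto simp: An_def Bn_def)
  have "incseq An" "incseq Bn"
    by (auto simp: An_def Bn_def incseq_def)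
  moreover have "range An \<subseteq> sets lborel" "range Bn \<subseteq> sets lborel"
    by auto
  moreover have "(\<Union>n. An n) = A"
  proof -
    have "\<exists>n. x \<le> a + real n" for x
      using real_arch_simple[of "x - a"] by (auto simp: algebra_simps)
    then show ?thesis by (auto simp: An_def)
  qed
  moreover have "(\<Union>n. Bn n) = B"
  proof -
    have "\<exists>n. b - real n \<le> x" for x
      using real_arch_simple[of "b - x"] by (auto simp: algebra_simps)
    then show ?thesis by (auto simp: Bn_def)
  qed
  ultimately have "(\<lambda>n. emeasure lborel (An n)) \<longlonglongrightarrow> emeasure lborel A"
      "(\<lambda>n. emeasure lborel (Bn n)) \<longlonglongrightarrow> emeasure lborel B"
    using Lim_emeasure_incseq[of An lborel] Lim_emeasure_incseq[of Bn lborel] by auto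
  then have "(\<lambda>n. emeasure lborel (An n) + emeasure lborel (Bn n)) \<longlonglongrightarrow> emeasure lborel A + emeasure lborel B"
    by (intro tendsto_add)
  then show ?thesis
  proof (rule LIMSEQ_le_const2, intro exI allI impI)
    fix n :: nat
    show "emeasure lborel (An n) + emeasure lborel (Bn n) \<le> emeasure lborel C"
      by (rule bdd) (use ab in \<open>simp_all add: An_def Bn_def, auto\<close>)
  qed
qed

section \<open>The integral inequality on the line\<close>

lemma emeasure_levels_le:
  assumes "0 < m"
  shows "ennreal m * emeasure lborel {t. 0 < t \<and> t < 1 \<and> ennreal (t * m) \<le> u} = min u (ennreal m)"
proof (cases "ennreal m \<le> u")
  case True
  have "ennreal (t * m) \<le> u" if "0 < t" "t < 1" for t
  proof -
    have "ennreal (t * m) \<le> ennreal m" using that assms by (intro ennreal_leI) simp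
    with True show ?thesis by simp
  qed
  then have "{t. 0 < t \<and> t < 1 \<and> ennreal (t * m) \<le> u} = {0<..<1}" by auto
  then show ?thesis using True by (simp add: min_def)
next
  case False
  then obtain v where v: "u = ennreal v" "0 \<le> v" "v < m"
    by (cases u) (auto simp: not_le ennreal_less_iff)
  have "{t. 0 < t \<and> t < 1 \<and> ennreal (t * m) \<le> u} = {0<..v / m}"
  proof -
    have "0 < t \<and> t < 1 \<and> ennreal (t * m) \<le> u \<longleftrightarrow> 0 < t \<and> t \<le> v / m" for t
    proof -
      have "ennreal (t * m) \<le> u \<longleftrightarrow> t \<le> v / m"
        using v assms by (simp add: ennreal_le_iff pos_le_divide_eq)
      moreover have "v / m < 1" using v assms by simp
      ultimately show ?thesis by auto
    qed
    then show ?thesis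
      unfolding set_eq_iff mem_Collect_eq greaterThanAtMost_iff by (rule allI)
  qed
  moreover have "emeasure lborel {0<..v / m} = ennreal (v / m)" using v assms by simp
  ultimately show ?thesis
    using v False assms by (simp add: ennreal_mult'[symmetric] min_def)
qed

text \<open>Layer-cake formula, by Fubini on the region of pairs \<open>(t, x)\<close> with
  \<open>t * m\<close> below \<open>f x\<close>. Levels are measured as fractions \<open>t\<close>
  of \<open>m\<close>, so that functions of different heights can be compared at the same
  \<open>t\<close>; the part of \<open>f\<close> above \<open>m\<close> is cut off by the
  minimum.\<close>

lemma nn_integral_levels:
  fixes f :: "real \<Rightarrow> ennreal"
  assumes [measurable]: "f \<in> borel_measurable borel" and m: "0 < m"
  shows "ennreal m * (\<integral>\<^sup>+t. indicator {0<..<1} t * emeasure lborel {x. ennreal (t * m) \<le> f x} \<partial>lborel) =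
      (\<integral>\<^sup>+x. min (f x) (ennreal m) \<partial>lborel)"
    and "(\<lambda>t. indicator {0<..<1::real} t * emeasure lborel {x. ennreal (t * m) \<le> f x}) \<in> borel_measurable borel"
proof -
  let ?I = "\<lambda>t x. indicator {t. 0 < t \<and> t < 1 \<and> ennreal (t * m) \<le> f x} t :: ennreal"
  have meas: "(\<lambda>(t, x). ?I t x) \<in> borel_measurable (lborel \<Otimes>\<^sub>M lborel)"
    by measurable
  have eq: "indicator {0<..<1} t * emeasure lborel {x. ennreal (t * m) \<le> f x} = (\<integral>\<^sup>+x. ?I t x \<partial>lborel)" for t
  proof -
    have "(\<integral>\<^sup>+x. ?I t x \<partial>lborel) = (\<integral>\<^sup>+x. indicator {0<..<1} t * indicator {x. ennreal (t * m) \<le> f x} x \<partial>lborel)"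
      by (intro nn_integral_cong) (auto split: split_indicator)
    also have "\<dots> = indicator {0<..<1} t * emeasure lborel {x. ennreal (t * m) \<le> f x}"
      by (subst nn_integral_cmult) auto
    finally show ?thesis by simp
  qed
  have "(\<lambda>t. \<integral>\<^sup>+x. ?I t x \<partial>lborel) \<in> borel_measurable lborel"
    by (intro lborel.borel_measurable_nn_integral meas)
  then show "(\<lambda>t. indicator {0<..<1::real} t * emeasure lborel {x. ennreal (t * m) \<le> f x}) \<in> borel_measurable borel"
    unfolding eq by simp
  have "(\<integral>\<^sup>+t. \<integral>\<^sup>+x. ?I t x \<partial>lborel \<partial>lborel) = (\<integral>\<^sup>+x. \<integral>\<^sup>+t. ?I t x \<partial>lborel \<partial>lborel)"
    by (rule lborel_pair.Fubini'[OF meas, symmetric])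
  also have "\<dots> = (\<integral>\<^sup>+x. emeasure lborel {t. 0 < t \<and> t < 1 \<and> ennreal (t * m) \<le> f x} \<partial>lborel)"
    by (intro nn_integral_cong nn_integral_indicator) measurable
  finally have "ennreal m * (\<integral>\<^sup>+t. \<integral>\<^sup>+x. ?I t x \<partial>lborel \<partial>lborel) =
      (\<integral>\<^sup>+x. ennreal m * emeasure lborel {t. 0 < t \<and> t < 1 \<and> ennreal (t * m) \<le> f x} \<partial>lborel)"
  proof (simp only:, subst nn_integral_cmult)
    have "(\<lambda>x. \<integral>\<^sup>+t. ?I t x \<partial>lborel) \<in> borel_measurable lborel"
      by (intro lborel.borel_measurable_nn_integral) measurable
    then show "(\<lambda>x. emeasure lborel {t. 0 < t \<and> t < 1 \<and> ennreal (t * m) \<le> f x}) \<in> borel_measurable lborel"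
      by (subst (asm) nn_integral_indicator) (auto)
  qed simp
  then show "ennreal m * (\<integral>\<^sup>+t. indicator {0<..<1} t * emeasure lborel {x. ennreal (t * m) \<le> f x} \<partial>lborel) =
      (\<integral>\<^sup>+x. min (f x) (ennreal m) \<partial>lborel)"
    unfolding eq emeasure_levels_le[OF m] .
qed

text \<open>Boundedness makes the suprema \<open>mf\<close> and \<open>mg\<close> finite. At each
  fraction \<open>t\<close> the superlevel sets of \<open>f\<close> and \<open>g\<close> add into
  one of \<open>h\<close>; Brunn-Minkowski on the line, integrated over \<open>t\<close>, gives
  \<open>U + V \<le> W\<close> for the normalised integrals, and \<open>power_sum_Suc_le\<close>
  restores the heights.\<close>

lemma nn_integral_power_sum_bounded:
  fixes f g h :: "real \<Rightarrow> ennreal"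
  assumes [measurable]: "f \<in> borel_measurable borel" "g \<in> borel_measurable borel" "h \<in> borel_measurable borel"
    and r: "0 \<le> r"
    and fgh: "\<And>x y a b. 0 < a \<Longrightarrow> 0 < b \<Longrightarrow> ennreal a \<le> f x \<Longrightarrow> ennreal b \<le> g y \<Longrightarrow> ennreal (power_sum r a b) \<le> h (x + y)"
    and fk: "\<And>x. f x \<le> ennreal k" and gk: "\<And>x. g x \<le> ennreal k"
    and a: "0 < a" "ennreal a \<le> (\<integral>\<^sup>+x. f x \<partial>lborel)"
    and b: "0 < b" "ennreal b \<le> (\<integral>\<^sup>+x. g x \<partial>lborel)"
  shows "ennreal (power_sum (r + 1) a b) \<le> (\<integral>\<^sup>+x. h x \<partial>lborel)"
proof -
  have sup: "\<exists>m>0. (\<forall>x. u x \<le> ennreal m) \<and> (\<forall>t. 0 < t \<longrightarrow> t < 1 \<longrightarrow> (\<exists>x. ennreal (t * m) \<le> u x))"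
    if uk: "\<And>x. u x \<le> ennreal k" and c: "0 < c" "ennreal c \<le> (\<integral>\<^sup>+x. u x \<partial>lborel)" for u :: "real \<Rightarrow> ennreal" and c
  proof -
    have "(SUP x. u x) \<le> ennreal k" by (intro SUP_least uk)
    then obtain m where m: "(SUP x. u x) = ennreal m" "0 \<le> m"
      by (cases "SUP x. u x") (auto simp: top_unique)
    have um: "u x \<le> ennreal m" for x by (metis m(1) SUP_upper UNIV_I)
    have "m \<noteq> 0"
    proof
      assume "m = 0"
      then have "(\<integral>\<^sup>+x. u x \<partial>lborel) = 0" using um by simp
      with c show False by simp
    qed
    then have m0: "0 < m" using m by simp
    have "\<exists>x. ennreal (t * m) \<le> u x" if "0 < t" "t < 1" for t
    proof -
      have "ennreal (t * m) < (SUP x. u x)" unfolding m using that m0 by (simp add: ennreal_less_iff)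
      then show ?thesis by (auto simp: less_SUP_iff intro: less_imp_le)
    qed
    with m0 um show ?thesis by blast
  qed
  obtain mf where mf: "0 < mf" "\<And>x. f x \<le> ennreal mf" "\<And>t. 0 < t \<Longrightarrow> t < 1 \<Longrightarrow> \<exists>x. ennreal (t * mf) \<le> f x"
    using sup[OF fk a] by blast
  obtain mg where mg: "0 < mg" "\<And>x. g x \<le> ennreal mg" "\<And>t. 0 < t \<Longrightarrow> t < 1 \<Longrightarrow> \<exists>x. ennreal (t * mg) \<le> g x"
    using sup[OF gk b] by blast
  \<comment> \<open>By homogeneity of \<open>power_sum\<close>, the levels \<open>t * mf\<close> and
    \<open>t * mg\<close> combine to \<open>t * m\<close>, with the same \<open>t\<close>.\<close>
  define m where "m = power_sum r mf mg"
  have m: "0 < m" unfolding m_def by (intro power_sum_pos mf mg)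
  let ?L = "\<lambda>u c t. indicator {0<..<1} t * emeasure lborel {x. ennreal (t * c) \<le> u x}"
  define U where "U = (\<integral>\<^sup>+t. ?L f mf t \<partial>lborel)"
  define V where "V = (\<integral>\<^sup>+t. ?L g mg t \<partial>lborel)"
  define W where "W = (\<integral>\<^sup>+t. ?L h m t \<partial>lborel)"
  have U: "ennreal mf * U = (\<integral>\<^sup>+x. f x \<partial>lborel)"
    unfolding U_def using mf by (subst nn_integral_levels) (auto simp: min_def intro!: nn_integral_cong)
  have V: "ennreal mg * V = (\<integral>\<^sup>+x. g x \<partial>lborel)"
    unfolding V_def using mg by (subst nn_integral_levels) (auto simp: min_def intro!: nn_integral_cong)
  \<comment> \<open>Only an inequality, since \<open>h\<close> may exceed \<open>m\<close>.\<close>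
  have W: "ennreal m * W \<le> (\<integral>\<^sup>+x. h x \<partial>lborel)"
    unfolding W_def using m by (subst nn_integral_levels) (auto intro!: nn_integral_mono)
  have Ua: "ennreal (a / mf) \<le> U" 
  proof -
    have "ennreal (1 / mf) * ennreal a \<le> ennreal (1 / mf) * (ennreal mf * U)"
      unfolding U by (intro mult_left_mono a) simp
    then show ?thesis using mf a by (simp add: mult.assoc[symmetric] ennreal_mult'[symmetric])
  qed
  have Vb: "ennreal (b / mg) \<le> V"
  proof -
    have "ennreal (1 / mg) * ennreal b \<le> ennreal (1 / mg) * (ennreal mg * V)"
      unfolding V by (intro mult_left_mono b) simp
    then show ?thesis using mg b by (simp add: mult.assoc[symmetric] ennreal_mult'[symmetric])
  qed
  have "U + V = (\<integral>\<^sup>+t. ?L f mf t + ?L g mg t \<partial>lborel)"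
    unfolding U_def V_def
    by (rule nn_integral_add[symmetric]) (use nn_integral_levels(2) mf mg in auto)
  also have "\<dots> \<le> W"
    unfolding W_def
  proof (intro nn_integral_mono)
    fix t :: real
    show "?L f mf t + ?L g mg t \<le> ?L h m t"
    proof (cases "t \<in> {0<..<1}")
      case True
      then have t: "0 < t" "t < 1" by auto
      \<comment> \<open>As \<open>t < 1\<close>, both levels lie strictly below the suprema, so the
        two superlevel sets are nonempty, as the sumset lemma demands.\<close>
      have "emeasure lborel {x. ennreal (t * mf) \<le> f x} + emeasure lborel {x. ennreal (t * mg) \<le> g x}
          \<le> emeasure lborel {x. ennreal (t * m) \<le> h x}"
      proof (rule emeasure_sumset_real)
        fix x y assume "x \<in> {x. ennreal (t * mf) \<le> f x}" "y \<in> {x. ennreal (t * mg) \<le> g x}"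
        then show "x + y \<in> {x. ennreal (t * m) \<le> h x}"
          using fgh[of "t * mf" "t * mg" x y] t mf(1) mg(1) r by (simp add: m_def power_sum_scale)
      qed (use mf(3)[OF t] mg(3)[OF t] in auto)
      with t show ?thesis by simp
    qed simp
  qed
  finally have UVW: "U + V \<le> W" .
  have "power_sum (r + 1) (a / mf * mf) (b / mg * mg) \<le> m * (a / mf + b / mg)"
    unfolding m_def by (rule power_sum_Suc_le) (use r mf mg a b in auto)
  then have "ennreal (power_sum (r + 1) a b) \<le> ennreal (m * (a / mf + b / mg))"
    using mf mg by (intro ennreal_leI) simp
  also have "\<dots> = ennreal m * (ennreal (a / mf) + ennreal (b / mg))"
    using m mf mg a b by (simp add: ennreal_mult' ennreal_plus[symmetric] del: ennreal_plus)
  also have "\<dots> \<le> ennreal m * W"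
    by (intro mult_left_mono order_trans[OF add_mono[OF Ua Vb] UVW]) simp
  finally show ?thesis using W by simp
qed

lemma SUP_nn_integral_min_of_nat:
  fixes f :: "'a \<Rightarrow> ennreal"
  assumes [measurable]: "f \<in> borel_measurable M"
  shows "(SUP k::nat. \<integral>\<^sup>+x. min (f x) (of_nat k) \<partial>M) = (\<integral>\<^sup>+x. f x \<partial>M)"
proof -
  have "(SUP k::nat. min u (of_nat k)) = u" for u :: ennreal
  proof -
    have "(SUP k::nat. min u (of_nat k)) = min u (SUP k::nat. of_nat k)"
      by (simp add: inf_min[symmetric] inf_SUP)
    then show ?thesis by (simp add: ennreal_SUP_of_nat_eq_top)
  qed
  then show ?thesis
    by (subst nn_integral_monotone_convergence_SUP[symmetric])
       (auto simp: incseq_def le_fun_def min.coboundedI2)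
qed

text \<open>Boundedness is removed by truncation: lowering \<open>f\<close> and \<open>g\<close>
  preserves the hypothesis on sums, and the integrals of the truncations converge to the full
  ones.\<close>

lemma nn_integral_power_sum_real:
  fixes f g h :: "real \<Rightarrow> ennreal"
  assumes [measurable]: "f \<in> borel_measurable borel" "g \<in> borel_measurable borel" "h \<in> borel_measurable borel"
    and r: "0 \<le> r"
    and fgh: "\<And>x y a b. 0 < a \<Longrightarrow> 0 < b \<Longrightarrow> ennreal a \<le> f x \<Longrightarrow> ennreal b \<le> g y \<Longrightarrow> ennreal (power_sum r a b) \<le> h (x + y)"
    and a: "0 < a" "ennreal a \<le> (\<integral>\<^sup>+x. f x \<partial>lborel)"
    and b: "0 < b" "ennreal b \<le> (\<integral>\<^sup>+x. g x \<partial>lborel)"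
  shows "ennreal (power_sum (r + 1) a b) \<le> (\<integral>\<^sup>+x. h x \<partial>lborel)"
proof -
  \<comment> \<open>The factor \<open>c < 1\<close> gives the strict slack with which a finite
    truncation level already suffices. Homogeneity pulls \<open>c\<close> out of the power sum, and
    \<open>c\<close> tends to one at the end.\<close>
  have step: "ennreal (c * power_sum (r + 1) a b) \<le> (\<integral>\<^sup>+x. h x \<partial>lborel)" if c: "0 < c" "c < 1" for c
  proof -
    have "ennreal (c * a) < ennreal a" using c a by (simp add: ennreal_less_iff)
    also have "\<dots> \<le> (SUP k::nat. \<integral>\<^sup>+x. min (f x) (of_nat k) \<partial>lborel)"
      using a by (simp add: SUP_nn_integral_min_of_nat)
    finally obtain k where k: "ennreal (c * a) < (\<integral>\<^sup>+x. min (f x) (of_nat k) \<partial>lborel)"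
      by (auto simp: less_SUP_iff)
    have "ennreal (c * b) < ennreal b" using c b by (simp add: ennreal_less_iff)
    also have "\<dots> \<le> (SUP k::nat. \<integral>\<^sup>+x. min (g x) (of_nat k) \<partial>lborel)"
      using b by (simp add: SUP_nn_integral_min_of_nat)
    finally obtain l where l: "ennreal (c * b) < (\<integral>\<^sup>+x. min (g x) (of_nat l) \<partial>lborel)"
      by (auto simp: less_SUP_iff)
    have "ennreal (power_sum (r + 1) (c * a) (c * b)) \<le> (\<integral>\<^sup>+x. h x \<partial>lborel)"
    proof (rule nn_integral_power_sum_bounded[where f = "\<lambda>x. min (f x) (of_nat k)" and g = "\<lambda>x. min (g x) (of_nat l)" and k = "real (max k l)"])
      show "min (f x) (of_nat k) \<le> ennreal (real (max k l))" "min (g x) (of_nat l) \<le> ennreal (real (max k l))" for x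
        by (auto simp: ennreal_of_nat_eq_real_of_nat intro!: min.coboundedI2 ennreal_leI)
    qed (use r fgh a b c k l in auto)
    then show ?thesis using c a b r by (simp add: power_sum_scale)
  qed
  show ?thesis
  proof (cases "\<integral>\<^sup>+x. h x \<partial>lborel")
    case (real H)
    then have "c * power_sum (r + 1) a b \<le> H" if "0 < c" "c < 1" for c
      using step[OF that] by (simp add: ennreal_le_iff)
    then have "power_sum (r + 1) a b \<le> H" by (rule field_le_mult_one_interval)
    then show ?thesis using real by (simp add: ennreal_leI)
  qed simp
qed

section \<open>From the line to Euclidean space\<close>

text \<open>Induction on the coordinates. By the induction hypothesis the integrals over the slices
  with fixed coordinate \<open>j\<close> satisfy the hypothesis on the line with exponent
  \<open>r + card I\<close>, and integrating over \<open>j\<close> adds one more.\<close>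

lemma nn_integral_power_sum_PiM:
  fixes f g h :: "('i \<Rightarrow> real) \<Rightarrow> ennreal"
  assumes "finite I" and r: "0 \<le> r"
    and "f \<in> borel_measurable (\<Pi>\<^sub>M i\<in>I. lborel)" "g \<in> borel_measurable (\<Pi>\<^sub>M i\<in>I. lborel)"
      "h \<in> borel_measurable (\<Pi>\<^sub>M i\<in>I. lborel)"
    and "\<And>x y a b. 0 < a \<Longrightarrow> 0 < b \<Longrightarrow> ennreal a \<le> f x \<Longrightarrow> ennreal b \<le> g y \<Longrightarrow>
      ennreal (power_sum r a b) \<le> h (\<lambda>i\<in>I. x i + y i)"
    and "0 < a" "ennreal a \<le> (\<integral>\<^sup>+x. f x \<partial>(\<Pi>\<^sub>M i\<in>I. lborel))"
    and "0 < b" "ennreal b \<le> (\<integral>\<^sup>+x. g x \<partial>(\<Pi>\<^sub>M i\<in>I. lborel))"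
  shows "ennreal (power_sum (r + card I) a b) \<le> (\<integral>\<^sup>+x. h x \<partial>(\<Pi>\<^sub>M i\<in>I. lborel))"
  using assms(1,3-)
proof (induction I arbitrary: f g h a b rule: finite_induct)
  case empty
  interpret product_sigma_finite "\<lambda>_. lborel :: real measure" ..
  show ?case
    using empty.prems(4)[of a b "\<lambda>_. undefined" "\<lambda>_. undefined"] empty.prems(5-)
    by (simp add: nn_integral_empty restrict_def)
next
  case (insert j I)
  interpret product_sigma_finite "\<lambda>_. lborel :: real measure" ..
  interpret I: sigma_finite_measure "\<Pi>\<^sub>M i\<in>I. lborel :: real measure"
    by (rule sigma_finite) fact
  note [measurable] = insert.prems(1-3)
  have sec: "(\<lambda>x. u (x(j := s))) \<in> borel_measurable (\<Pi>\<^sub>M i\<in>I. lborel)"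
      "(\<lambda>s. \<integral>\<^sup>+x. u (x(j := s)) \<partial>(\<Pi>\<^sub>M i\<in>I. lborel)) \<in> borel_measurable borel"
    if [measurable]: "u \<in> borel_measurable (\<Pi>\<^sub>M i\<in>insert j I. lborel)"
    for u :: "('i \<Rightarrow> real) \<Rightarrow> ennreal" and s
  proof -
    show "(\<lambda>x. u (x(j := s))) \<in> borel_measurable (\<Pi>\<^sub>M i\<in>I. lborel)"
      by measurable
    have "(\<lambda>s. \<integral>\<^sup>+x. u (x(j := s)) \<partial>(\<Pi>\<^sub>M i\<in>I. lborel)) \<in> borel_measurable lborel"
      by measurable
    then show "(\<lambda>s. \<integral>\<^sup>+x. u (x(j := s)) \<partial>(\<Pi>\<^sub>M i\<in>I. lborel)) \<in> borel_measurable borel"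
      by simp
  qed
  \<comment> \<open>Adding two points slice by slice adds their coordinates \<open>j\<close>: slices
    at \<open>s\<close> and \<open>t\<close> go to the slice at \<open>s + t\<close>.\<close>
  have upd: "(\<lambda>i\<in>insert j I. (x(j := s)) i + (y(j := t)) i) = (\<lambda>i\<in>I. x i + y i)(j := s + t)" for x y s t
    using insert.hyps by (auto simp: fun_eq_iff restrict_def)
  note int = product_nn_integral_insert_rev[OF insert.hyps(1,2)]
  have "ennreal (power_sum (r + card I + 1) a b) \<le>
      (\<integral>\<^sup>+s. (\<integral>\<^sup>+x. h (x(j := s)) \<partial>(\<Pi>\<^sub>M i\<in>I. lborel)) \<partial>lborel)"
  proof (rule nn_integral_power_sum_real)
    fix s t c d
    assume cd: "0 < c" "0 < d" "ennreal c \<le> (\<integral>\<^sup>+x. f (x(j := s)) \<partial>(\<Pi>\<^sub>M i\<in>I. lborel))"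
      "ennreal d \<le> (\<integral>\<^sup>+x. g (x(j := t)) \<partial>(\<Pi>\<^sub>M i\<in>I. lborel))"
    show "ennreal (power_sum (r + card I) c d) \<le> (\<integral>\<^sup>+x. h (x(j := s + t)) \<partial>(\<Pi>\<^sub>M i\<in>I. lborel))"
    proof (rule insert.IH[OF _ _ _ _ cd(1,3,2,4)])
      fix x y a b assume "0 < a" "0 < b" "ennreal a \<le> f (x(j := s))" "ennreal b \<le> g (y(j := t))"
      then show "ennreal (power_sum r a b) \<le> h ((\<lambda>i\<in>I. x i + y i)(j := s + t))"
        unfolding upd[symmetric] by (rule insert.prems(4))
    qed (rule sec insert.prems)+
  next
    show "ennreal a \<le> (\<integral>\<^sup>+s. (\<integral>\<^sup>+x. f (x(j := s)) \<partial>(\<Pi>\<^sub>M i\<in>I. lborel)) \<partial>lborel)"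
      unfolding int[OF insert.prems(1), symmetric] by (rule insert.prems)
    show "ennreal b \<le> (\<integral>\<^sup>+s. (\<integral>\<^sup>+x. g (x(j := s)) \<partial>(\<Pi>\<^sub>M i\<in>I. lborel)) \<partial>lborel)"
      unfolding int[OF insert.prems(2), symmetric] by (rule insert.prems)
    show "0 \<le> r + card I" using r by simp
  qed (rule sec insert.prems)+
  moreover have "r + card I + 1 = r + card (insert j I)" using insert.hyps by simp
  ultimately show ?case
    unfolding int[OF insert.prems(3)] by metis
qed

text \<open>Lebesgue measure is the image of the product measure under the coordinate map
  \<open>T\<close>, which is additive.\<close>

lemma nn_integral_power_sum_lborel:
  fixes f g h :: "'a::euclidean_space \<Rightarrow> ennreal"
  assumes [measurable]: "f \<in> borel_measurable borel" "g \<in> borel_measurable borel" "h \<in> borel_measurable borel"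
    and r: "0 \<le> r"
    and fgh: "\<And>x y a b. 0 < a \<Longrightarrow> 0 < b \<Longrightarrow> ennreal a \<le> f x \<Longrightarrow> ennreal b \<le> g y \<Longrightarrow> ennreal (power_sum r a b) \<le> h (x + y)"
    and a: "0 < a" "ennreal a \<le> (\<integral>\<^sup>+x. f x \<partial>lborel)"
    and b: "0 < b" "ennreal b \<le> (\<integral>\<^sup>+x. g x \<partial>lborel)"
  shows "ennreal (power_sum (r + DIM('a)) a b) \<le> (\<integral>\<^sup>+x. h x \<partial>lborel)"
proof -
  define T where "T x = (\<Sum>b\<in>Basis. x b *\<^sub>R b)" for x :: "'a \<Rightarrow> real"
  have T[measurable]: "T \<in> (\<Pi>\<^sub>M b\<in>Basis. lborel) \<rightarrow>\<^sub>M borel"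
    unfolding T_def by measurable
  have int: "(\<integral>\<^sup>+x. u x \<partial>lborel) = (\<integral>\<^sup>+x. u (T x) \<partial>(\<Pi>\<^sub>M b\<in>Basis. lborel))"
    if "u \<in> borel_measurable borel" for u :: "'a \<Rightarrow> ennreal"
    by (subst lborel_eq, fold T_def, subst nn_integral_distr) (use that in auto)
  have add: "T (\<lambda>i\<in>Basis. x i + y i) = T x + T y" for x y
    by (simp add: T_def sum.distrib scaleR_add_left)
  show ?thesis
    unfolding int[OF assms(3)]
  proof (rule nn_integral_power_sum_PiM[where f = "\<lambda>x. f (T x)" and g = "\<lambda>x. g (T x)"])
    fix x y c d assume "0 < c" "0 < d" "ennreal c \<le> f (T x)" "ennreal d \<le> g (T y)"
    then show "ennreal (power_sum r c d) \<le> h (T (\<lambda>i\<in>Basis. x i + y i))"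
      unfolding add by (rule fgh)
  next
    show "ennreal a \<le> (\<integral>\<^sup>+x. f (T x) \<partial>(\<Pi>\<^sub>M b\<in>Basis. lborel))"
      using a int[OF assms(1)] by simp
    show "ennreal b \<le> (\<integral>\<^sup>+x. g (T x) \<partial>(\<Pi>\<^sub>M b\<in>Basis. lborel))"
      using b int[OF assms(2)] by simp
  qed (use r a b in \<open>simp_all\<close>)
qed

text \<open>The weight is only Lebesgue measurable, while the slicing above works with Borel
  functions. The hypothesis on sums is pointwise and would not survive an arbitrary change on a null
  set, so \<open>u\<close> is replaced by Borel functions that bound it everywhere: on a Borel null
  set containing all disagreements with a Borel version, the values are 0 and
  \<open>top\<close>.\<close>

lemma lebesgue_borel_sandwich:
  fixes u :: "'a::euclidean_space \<Rightarrow> ennreal"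
  assumes "u \<in> borel_measurable lebesgue"
  obtains v w where "v \<in> borel_measurable borel" "w \<in> borel_measurable borel"
    "\<And>x. v x \<le> u x" "\<And>x. u x \<le> w x"
    "(\<integral>\<^sup>+x. v x \<partial>lborel) = (\<integral>\<^sup>+x. u x \<partial>lebesgue)" "(\<integral>\<^sup>+x. w x \<partial>lborel) = (\<integral>\<^sup>+x. u x \<partial>lebesgue)"
proof -
  obtain u' where u'[measurable]: "u' \<in> borel_measurable borel" and ae: "AE x in lborel. u x = u' x"
    using completion_ex_borel_measurable[OF assms] by auto
  obtain X where X: "{x \<in> space lborel. u x \<noteq> u' x} \<subseteq> X" "X \<in> null_sets lborel"
    using ae by (auto elim!: AE_E simp: null_sets_def)
  have [measurable]: "X \<in> sets borel" using X by auto
  have notX: "AE x in lborel. x \<notin> X" by (rule AE_not_in[OF X(2)])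
  have eq: "u x = u' x" if "x \<notin> X" for x using X that by auto
  show ?thesis
  proof (rule that[of "\<lambda>x. if x \<in> X then 0 else u' x" "\<lambda>x. if x \<in> X then top else u' x"])
    show "(\<integral>\<^sup>+x. (if x \<in> X then 0 else u' x) \<partial>lborel) = (\<integral>\<^sup>+x. u x \<partial>lebesgue)"
      unfolding nn_integral_completion
      by (rule nn_integral_cong_AE) (use notX in eventually_elim, simp add: eq)
    show "(\<integral>\<^sup>+x. (if x \<in> X then top else u' x) \<partial>lborel) = (\<integral>\<^sup>+x. u x \<partial>lebesgue)"
      unfolding nn_integral_completion
      by (rule nn_integral_cong_AE) (use notX in eventually_elim, simp add: eq)
  qed (auto simp: eq)
qed

text \<open>Replacing \<open>f\<close> and \<open>g\<close> by Borel functions below them and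
  \<open>h\<close> by one above it keeps the hypothesis and all three integrals.\<close>

lemma nn_integral_power_sum_lebesgue:
  fixes f g h :: "'a::euclidean_space \<Rightarrow> ennreal"
  assumes meas: "f \<in> borel_measurable lebesgue" "g \<in> borel_measurable lebesgue" "h \<in> borel_measurable lebesgue"
    and r: "0 \<le> r"
    and fgh: "\<And>x y a b. 0 < a \<Longrightarrow> 0 < b \<Longrightarrow> ennreal a \<le> f x \<Longrightarrow> ennreal b \<le> g y \<Longrightarrow> ennreal (power_sum r a b) \<le> h (x + y)"
    and a: "0 < a" "ennreal a \<le> (\<integral>\<^sup>+x. f x \<partial>lebesgue)"
    and b: "0 < b" "ennreal b \<le> (\<integral>\<^sup>+x. g x \<partial>lebesgue)"
  shows "ennreal (power_sum (r + DIM('a)) a b) \<le> (\<integral>\<^sup>+x. h x \<partial>lebesgue)"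
proof -
  obtain f' where f': "f' \<in> borel_measurable borel" "\<And>x. f' x \<le> f x" "(\<integral>\<^sup>+x. f' x \<partial>lborel) = (\<integral>\<^sup>+x. f x \<partial>lebesgue)"
    using lebesgue_borel_sandwich[OF meas(1)] by metis
  obtain g' where g': "g' \<in> borel_measurable borel" "\<And>x. g' x \<le> g x" "(\<integral>\<^sup>+x. g' x \<partial>lborel) = (\<integral>\<^sup>+x. g x \<partial>lebesgue)"
    using lebesgue_borel_sandwich[OF meas(2)] by metis
  obtain h' where h': "h' \<in> borel_measurable borel" "\<And>x. h x \<le> h' x" "(\<integral>\<^sup>+x. h' x \<partial>lborel) = (\<integral>\<^sup>+x. h x \<partial>lebesgue)"
    using lebesgue_borel_sandwich[OF meas(3)] by metis
  show ?thesis
    unfolding h'(3)[symmetric]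
  proof (rule nn_integral_power_sum_lborel[OF f'(1) g'(1) h'(1) r])
    fix x y c d assume "0 < c" "0 < d" "ennreal c \<le> f' x" "ennreal d \<le> g' y"
    then show "ennreal (power_sum r c d) \<le> h' (x + y)"
      using fgh[of c d x y] f'(2)[of x] g'(2)[of y] h'(2)[of "x + y"] by (meson order_trans)
  qed (use a b f' g' in simp_all)
qed

section \<open>Brunn-Minkowski and scaling for the weighted measure\<close>

lemma nn_integral_lebesgue_scaleR:
  fixes f :: "'a::euclidean_space \<Rightarrow> ennreal"
  assumes f: "f \<in> borel_measurable lebesgue" and c: "0 < c"
  shows "(\<integral>\<^sup>+x. f x \<partial>lebesgue) = ennreal (c ^ DIM('a)) * (\<integral>\<^sup>+x. f (c *\<^sub>R x) \<partial>lebesgue)"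
proof -
  \<comment> \<open>The affine change of variables stretches each coordinate separately; equal
    factors \<open>c\<close> give the dilation.\<close>
  have T: "(\<lambda>x::'a. 0 + (\<Sum>j\<in>Basis. (c * (x \<bullet> j)) *\<^sub>R j)) = (\<lambda>x. c *\<^sub>R x)"
    by (simp add: scaleR_scaleR[symmetric] scaleR_sum_right[symmetric] euclidean_representation del: scaleR_scaleR)
  have meas: "(\<lambda>x::'a. c *\<^sub>R x) \<in> lebesgue \<rightarrow>\<^sub>M lebesgue"
    using lebesgue_affine_measurable[of "\<lambda>_::'a. c" 0] c unfolding T by simp
  have eq: "(lebesgue :: 'a measure) = density (distr lebesgue lebesgue (\<lambda>x. c *\<^sub>R x)) (\<lambda>_. ennreal (c ^ DIM('a)))"
    using lebesgue_affine_euclidean[of "\<lambda>_::'a. c" 0] c unfolding T by simp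
  have "(\<integral>\<^sup>+x. f x \<partial>lebesgue) =
      (\<integral>\<^sup>+x. f x \<partial>density (distr lebesgue lebesgue (\<lambda>x. c *\<^sub>R x)) (\<lambda>_. ennreal (c ^ DIM('a))))"
    using eq by (rule arg_cong)
  also have "\<dots> = ennreal (c ^ DIM('a)) * (\<integral>\<^sup>+x. f (c *\<^sub>R x) \<partial>lebesgue)"
    using f meas by (subst nn_integral_density) (auto simp: nn_integral_distr nn_integral_cmult)
  finally show ?thesis .
qed

text \<open>Taking \<open>p\<close>-th roots shows homogeneity of degree \<open>1 / p\<close>.
  Infinite \<open>p\<close> fits the same formula, since then \<open>1 / p = 0\<close> and
  \<open>t powr 0 = 1\<close>.\<close>

lemma weight_scaleR:
  assumes p: "0 < p" and w: "\<And>x. 0 \<le> w x" and hom: "p_homogeneous p w" and t: "0 < t"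
  shows "w (t *\<^sub>R x) = t powr real_of_ereal (1 / p) * w x"
proof (cases p)
  case (real p')
  then have p': "0 < p'" and inv: "1 / p = ereal (1 / p')" using p by (auto simp: one_ereal_def)
  have "w (t *\<^sub>R x) powr p' = t * w x powr p'"
    using hom t real by (simp add: p_homogeneous_def)
  then have "(w (t *\<^sub>R x) powr p') powr (1 / p') = (t * w x powr p') powr (1 / p')" by simp
  then have "w (t *\<^sub>R x) = t powr (1 / p') * w x"
    using p' t w by (simp add: powr_powr powr_mult)
  then show ?thesis by (simp add: inv)
qed (use p hom t in \<open>auto simp: p_homogeneous_def\<close>)

text \<open>Write \<open>x + y\<close> as the midpoint of \<open>2x\<close> and \<open>2y\<close>:
  the factor 2 from homogeneity cancels the factor 1/2 in the concavity inequality. For infinite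
  \<open>p\<close> both sides involve the maximum.\<close>

lemma weight_power_sum_le:
  assumes p: "0 < p" and w: "\<And>x. 0 \<le> w x"
    and conc: "p_concave p w" and hom: "p_homogeneous p w"
    and a: "0 < a" "a \<le> w x" and b: "0 < b" "b \<le> w y"
  shows "power_sum (real_of_ereal (1 / p)) a b \<le> w (x + y)"
proof -
  have pos: "w x > 0" "w y > 0" using a b by simp_all
  have sum: "(1 / 2) *\<^sub>R (2 *\<^sub>R x) + (1 - 1 / 2) *\<^sub>R (2 *\<^sub>R y) = x + y" by simp
  have pos2: "w (2 *\<^sub>R x) * w (2 *\<^sub>R y) > 0"
    using pos by (simp add: weight_scaleR[OF p w hom])
  have c: "w (x + y) \<ge> (if p = \<infinity> then max (w (2 *\<^sub>R x)) (w (2 *\<^sub>R y))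
           else (1 / 2 * w (2 *\<^sub>R x) powr real_of_ereal p + (1 - 1 / 2) * w (2 *\<^sub>R y) powr real_of_ereal p)
                  powr (1 / real_of_ereal p))"
    using conc[unfolded p_concave_def, rule_format, of "2 *\<^sub>R x" "2 *\<^sub>R y" "1 / 2"] pos2
    unfolding sum by simp
  have "power_sum (real_of_ereal (1 / p)) (w x) (w y) \<le> w (x + y)"
  proof (cases p)
    case (real p')
    then have p': "0 < p'" and inv: "1 / p = ereal (1 / p')" using p by (auto simp: one_ereal_def)
    have "w (2 *\<^sub>R z) powr p' = 2 * w z powr p'" for z
      using hom real by (simp add: p_homogeneous_def)
    then show ?thesis unfolding inv using c p' by (simp add: real power_sum_def)
  next
    case PInf
    have "w (2 *\<^sub>R z) = w z" for z
      using hom PInf by (simp add: p_homogeneous_def)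
    then show ?thesis using c PInf by (simp add: power_sum_def)
  qed (use p in simp)
  moreover have "0 \<le> real_of_ereal (1 / p)"
    using p by (cases p) (auto simp: one_ereal_def)
  ultimately show ?thesis
    using power_sum_mono[of "real_of_ereal (1 / p)" a b "w x" "w y"] a b by linarith
qed

text \<open>The integral inequality for \<open>w\<close> restricted to \<open>A\<close>,
  \<open>B\<close> and \<open>C\<close>. A positive lower bound on a restricted weight forces the
  point into the set.\<close>

lemma emeasure_sumset_density:
  fixes w :: "'a::euclidean_space \<Rightarrow> real"
  assumes w: "w \<in> borel_measurable lebesgue" and r: "0 \<le> r"
    and wsum: "\<And>x y a b. 0 < a \<Longrightarrow> 0 < b \<Longrightarrow> a \<le> w x \<Longrightarrow> b \<le> w y \<Longrightarrow> power_sum r a b \<le> w (x + y)"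
    and sets: "A \<in> sets lebesgue" "B \<in> sets lebesgue" "C \<in> sets lebesgue"
    and sub: "\<And>x y. x \<in> A \<Longrightarrow> y \<in> B \<Longrightarrow> x + y \<in> C"
    and a: "0 < a" "ennreal a \<le> emeasure (density lebesgue w) A"
    and b: "0 < b" "ennreal b \<le> emeasure (density lebesgue w) B"
  shows "ennreal (power_sum (r + DIM('a)) a b) \<le> emeasure (density lebesgue w) C"
proof -
  note [measurable] = w sets
  have em: "emeasure (density lebesgue w) X = (\<integral>\<^sup>+x. ennreal (w x) * indicator X x \<partial>lebesgue)"
    if "X \<in> sets lebesgue" for X
    using that by (subst emeasure_density) auto
  show ?thesis
    unfolding em[OF sets(3)]
  proof (rule nn_integral_power_sum_lebesgue)
    fix x y c d assume cd: "0 < c" "0 < d" "ennreal c \<le> ennreal (w x) * indicator A x"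
      "ennreal d \<le> ennreal (w y) * indicator B y"
    have level: "z \<in> X \<and> e \<le> w z" if "0 < e" "ennreal e \<le> ennreal (w z) * indicator X z" for z e X
      using that by (cases "z \<in> X") (auto simp: ennreal_le_iff2)
    have "x \<in> A" "y \<in> B" "c \<le> w x" "d \<le> w y"
      using level[OF cd(1,3)] level[OF cd(2,4)] by auto
    then show "ennreal (power_sum r c d) \<le> ennreal (w (x + y)) * indicator C (x + y)"
      using wsum[OF cd(1,2), of x y] sub by (simp add: ennreal_leI)
  qed (use a b r em sets in auto)
qed

text \<open>The Jacobian contributes the dimension to the exponent and the weight contributes
  \<open>r\<close>.\<close>

lemma emeasure_scaleR_density:
  fixes w :: "'a::euclidean_space \<Rightarrow> real"
  assumes w: "w \<in> borel_measurable lebesgue"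
    and hom: "\<And>x. w (t *\<^sub>R x) = t powr r * w x"
    and t: "0 < t" and K: "open K"
  shows "emeasure (density lebesgue w) ((*\<^sub>R) t ` K) = ennreal (t powr (r + DIM('a))) * emeasure (density lebesgue w) K"
proof -
  have [measurable]: "w \<in> borel_measurable lebesgue" "K \<in> sets lebesgue" "(*\<^sub>R) t ` K \<in> sets lebesgue"
    using w K t open_scaling[of t K] by auto
  have ind: "indicator ((*\<^sub>R) t ` K) (t *\<^sub>R x) = (indicator K x :: ennreal)" for x
    using t by (auto simp: indicator_def)
  have "emeasure (density lebesgue w) ((*\<^sub>R) t ` K) = (\<integral>\<^sup>+x. ennreal (w x) * indicator ((*\<^sub>R) t ` K) x \<partial>lebesgue)"
    by (subst emeasure_density) auto
  also have "\<dots> = ennreal (t ^ DIM('a)) * (\<integral>\<^sup>+x. ennreal (t powr r) * (ennreal (w x) * indicator K x) \<partial>lebesgue)"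
    using t by (subst nn_integral_lebesgue_scaleR[OF _ t]) (auto simp: ind hom ennreal_mult' mult.assoc)
  also have "\<dots> = ennreal (t ^ DIM('a)) * ennreal (t powr r) * emeasure (density lebesgue w) K"
    by (subst nn_integral_cmult) (auto simp: emeasure_density mult.assoc)
  also have "ennreal (t ^ DIM('a)) * ennreal (t powr r) = ennreal (t powr (r + DIM('a)))"
    using t by (simp add: powr_add powr_realpow ennreal_mult'[symmetric] mult.commute)
  finally show ?thesis .
qed

section \<open>Balls of semi-norms, and Bernoulli's inequality\<close>

lemma asym_seminorm_ball:
  fixes N :: "'a::euclidean_space \<Rightarrow> real"
  assumes N: "asym_seminorm N" and K: "K = {x. N x < 1}"
  shows "open K" and "0 \<in> K"
    and "\<And>s t. 0 < s \<Longrightarrow> 0 < t \<Longrightarrow> (*\<^sub>R) s ` K + (*\<^sub>R) t ` K = (*\<^sub>R) (s + t) ` K"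
proof -
  have sub: "N (x + y) \<le> N x + N y" and hom: "0 \<le> c \<Longrightarrow> N (c *\<^sub>R x) = c * N x" for x y c
    using N by (auto simp: asym_seminorm_def)
  \<comment> \<open>A finite convex function on a finite-dimensional space is continuous, so the
    strict unit ball is open.\<close>
  have "convex_on UNIV N"
  proof (rule convex_onI)
    fix t :: real and x y assume "0 < t" "t < 1"
    then show "N ((1 - t) *\<^sub>R x + t *\<^sub>R y) \<le> (1 - t) * N x + t * N y"
      using sub[of "(1 - t) *\<^sub>R x" "t *\<^sub>R y"] by (simp add: hom)
  qed simp
  then have "continuous_on UNIV N" by (intro convex_on_continuous) auto
  then show "open K" unfolding K by (intro open_Collect_less) auto
  show "0 \<in> K" using hom[of 0 0] by (simp add: K)
  fix s t :: real assume st: "0 < s" "0 < t"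
  show "(*\<^sub>R) s ` K + (*\<^sub>R) t ` K = (*\<^sub>R) (s + t) ` K"
  proof (intro equalityI subsetI)
    fix z assume "z \<in> (*\<^sub>R) s ` K + (*\<^sub>R) t ` K"
    then obtain x y where xy: "z = s *\<^sub>R x + t *\<^sub>R y" "N x < 1" "N y < 1"
      by (auto simp: set_plus_def K)
    have "N z \<le> s * N x + t * N y"
      using sub[of "s *\<^sub>R x" "t *\<^sub>R y"] st by (simp add: xy hom)
    also have "\<dots> < s * 1 + t * 1"
      using st xy by (intro add_strict_mono mult_strict_left_mono)
    finally have "N ((1 / (s + t)) *\<^sub>R z) < 1"
      using st by (simp add: hom)
    moreover have "z = (s + t) *\<^sub>R ((1 / (s + t)) *\<^sub>R z)" using st by simp
    ultimately show "z \<in> (*\<^sub>R) (s + t) ` K" unfolding K by blast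
  next
    fix z assume "z \<in> (*\<^sub>R) (s + t) ` K"
    then obtain x where "x \<in> K" "z = s *\<^sub>R x + t *\<^sub>R x" by (auto simp: scaleR_add_left)
    then show "z \<in> (*\<^sub>R) s ` K + (*\<^sub>R) t ` K" by (auto simp: set_plus_def)
  qed
qed

text \<open>Bernoulli's inequality \<open>1 + s * x \<le> (1 + x) powr s\<close> multiplied by
  \<open>m\<close>, where \<open>x\<close> is the ratio of \<open>e * c powr (1 / s)\<close> to
  \<open>m powr (1 / s)\<close>. The bound is affine in \<open>e\<close> with constant term
  \<open>m\<close>, hence ready for the difference quotient.\<close>

lemma power_sum_tangent_le:
  assumes s: "1 \<le> s" and pos: "0 < m" "0 < c" "0 < e"
  shows "m + s * c powr (1 / s) * m powr (1 - 1 / s) * e \<le> power_sum s m (e powr s * c)"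
proof -
  define x where "x = e * c powr (1 / s) / m powr (1 / s)"
  have x: "0 < x" using pos by (simp add: x_def)
  \<comment> \<open>Bernoulli from Young: the weighted geometric mean of \<open>1 + s * x\<close>
    and 1, with weights \<open>1 / s\<close> and \<open>1 - 1 / s\<close>, is at most their
    arithmetic mean \<open>1 + x\<close>.\<close>
  have "(1 + s * x) powr (1 / s) * 1 powr (1 - 1 / s) \<le> 1 / s * (1 + s * x) + (1 - 1 / s) * 1"
    using s x by (intro Youngs_inequality_0) (auto intro: add_pos_pos)
  also have "\<dots> = 1 + x" using s by (simp add: field_simps)
  finally have "((1 + s * x) powr (1 / s)) powr s \<le> (1 + x) powr s"
    using s by (intro powr_mono2) auto
  then have bern: "1 + s * x \<le> (1 + x) powr s"
    using s x by (simp add: powr_powr add_pos_pos less_imp_le)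
  have "m + s * c powr (1 / s) * m powr (1 - 1 / s) * e = m * (1 + s * x)"
    using pos by (simp add: x_def powr_diff algebra_simps)
  also have "\<dots> \<le> m * (1 + x) powr s" using bern pos by simp
  also have "\<dots> = (m powr (1 / s) * (1 + x)) powr s"
    using pos s x by (simp add: powr_mult powr_powr)
  also have "m powr (1 / s) * (1 + x) = m powr (1 / s) + (e powr s * c) powr (1 / s)"
    using pos s by (simp add: x_def powr_mult powr_powr algebra_simps)
  finally show ?thesis using s by (simp add: power_sum_def)
qed

section \<open>The isoperimetric inequality, its equality case and the minimizers\<close>

theorem corollary1p2:
  fixes p :: ereal and q :: real
    and w :: "real ^ 'n \<Rightarrow> real"
    and \<mu> :: "(real ^ 'n) measure"
    and N :: "real ^ 'n \<Rightarrow> real"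
    and K :: "(real ^ 'n) set"
  assumes "0 < p"
    and "0 < q" and "q \<le> 1 / real CARD('n)"
    and "ereal (1 / q) = 1 / p + ereal (real CARD('n))"
    and "\<And>x. 0 \<le> w x"
    and "w \<in> borel_measurable lebesgue"
    and "p_concave p w"
    and "p_homogeneous p w"
    and "\<mu> = density lebesgue (\<lambda>x. ennreal (w x))"
    and "asym_seminorm N"
    and "K = {x. N x < 1}"
  shows "(\<forall>A\<in>sets borel. emeasure \<mu> A < \<infinity> \<longrightarrow>
            outer_boundary_measure \<mu> K A \<ge> isoperimetric_bound \<mu> K q A)
       \<and> (\<forall>t>0. emeasure \<mu> ((*\<^sub>R) t ` K) < \<infinity> \<longrightarrow>
            outer_boundary_measure \<mu> K ((*\<^sub>R) t ` K) = isoperimetric_bound \<mu> K q ((*\<^sub>R) t ` K))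
       \<and> (\<forall>t>0. emeasure \<mu> ((*\<^sub>R) t ` K) < \<infinity> \<longrightarrow>
            isoperimetric_minimizer \<mu> K ((*\<^sub>R) t ` K))"
proof -
  note \<mu> = assms(9)
  define r where "r = real_of_ereal (1 / p)"
  have r: "0 \<le> r" and q_r: "1 / q = r + real CARD('n)"
    using assms(1,4) unfolding r_def by (cases p; auto simp: one_ereal_def)+
  define s where "s = 1 / q"
  have sq: "q = 1 / s" by (simp add: s_def)
  have s_r: "s = r + real DIM(real ^ 'n)" using q_r by (simp add: s_def)
  have "1 \<le> real CARD('n)" by (simp add: Suc_leI)
  then have s: "1 \<le> s" using r q_r unfolding s_def by linarith
  have K: "open K" "0 \<in> K" using asym_seminorm_ball[OF assms(10,11)] by auto
  have Kadd: "(*\<^sub>R) a ` K + (*\<^sub>R) b ` K = (*\<^sub>R) (a + b) ` K" if "0 < a" "0 < b" for a b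
    using that asym_seminorm_ball[OF assms(10,11)] by blast
  have scK: "emeasure \<mu> ((*\<^sub>R) t ` K) = ennreal (t powr s) * emeasure \<mu> K" if t: "0 < t" for t
    unfolding \<mu> s_r
    by (rule emeasure_scaleR_density[OF assms(6) _ t K(1)])
       (simp add: r_def weight_scaleR[OF assms(1,5,8) t])
  have openK: "open ((*\<^sub>R) t ` K)" if "0 < t" for t
    using that K by (intro open_scaling) auto
  have sets_\<mu>: "X \<in> sets \<mu>" if "X \<in> sets borel" for X using that by (simp add: \<mu>)

  have lower: "isoperimetric_bound \<mu> K q A \<le> outer_boundary_measure \<mu> K A"
    if A: "A \<in> sets borel" and fin: "emeasure \<mu> A < \<infinity>" for A
  proof (cases "emeasure \<mu> A = 0")
    case False
    then obtain m where m: "emeasure \<mu> A = ennreal m" "0 < m"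
      using fin by (cases "emeasure \<mu> A") (auto simp: less_le)
    \<comment> \<open>The real \<open>c\<close> stands in for the measure of \<open>K\<close>. It
      equals that measure when it is finite and positive, and can be taken arbitrarily large when it
      is infinite.\<close>
    have bound: "ennreal (s * c powr q * m powr (1 - q)) \<le> outer_boundary_measure \<mu> K A"
      if c: "0 < c" "ennreal c \<le> emeasure \<mu> K" for c
      unfolding outer_boundary_measure_def
    proof (intro Liminf_bounded)
      have "ennreal (s * c powr q * m powr (1 - q)) \<le> emeasure \<mu> (A + (*\<^sub>R) e ` K - A) / ennreal e"
        if e: "0 < e" for e
      proof -
        define L where "L = s * c powr q * m powr (1 - q)"
        have L: "0 \<le> L" using s by (simp add: L_def)
        let ?C = "A + (*\<^sub>R) e ` K"
        \<comment> \<open>A union of translates of an open set is open, so the enlarged set is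
          measurable.\<close>
        have "?C = (\<Union>x\<in>A. (+) x ` ((*\<^sub>R) e ` K))" by (auto simp: set_plus_def)
        then have "open ?C" using openK[OF e] by (auto intro: open_translation)
        then have C: "?C \<in> sets borel" by simp
        have "A \<subseteq> ?C" using K(2) by (force simp: set_plus_def)
        then have "emeasure \<mu> ?C = emeasure \<mu> A + emeasure \<mu> (?C - A)"
          using plus_emeasure[of A \<mu> "?C - A"] A C sets_\<mu> by (simp add: Un_absorb1)
        moreover have "ennreal (power_sum s m (e powr s * c)) \<le> emeasure \<mu> ?C"
          unfolding \<mu> s_r
        proof (rule emeasure_sumset_density[where A = A and B = "(*\<^sub>R) e ` K", OF assms(6) r])
          show "power_sum r a b \<le> w (x + y)" if "0 < a" "0 < b" "a \<le> w x" "b \<le> w y" for x y a b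
            unfolding r_def using that by (intro weight_power_sum_le assms) auto
          have "ennreal (e powr s * c) \<le> ennreal (e powr s) * emeasure \<mu> K"
            using c by (simp add: ennreal_mult' mult_left_mono)
          then show "ennreal (e powr (r + real DIM(real ^ 'n)) * c) \<le> emeasure (density lebesgue (\<lambda>x. ennreal (w x))) ((*\<^sub>R) e ` K)"
            using scK[OF e] unfolding \<mu> s_r by simp
        qed (use A C openK[OF e] m c e \<mu> in \<open>auto intro: set_plus_intro\<close>)
        moreover have "m + L * e \<le> power_sum s m (e powr s * c)"
          unfolding L_def sq by (rule power_sum_tangent_le[OF s m(2) c(1) e])
        ultimately have "ennreal (m + L * e) \<le> ennreal m + emeasure \<mu> (?C - A)"
          using m(1) by (metis ennreal_leI order_trans)
        then have "ennreal (L * e) \<le> emeasure \<mu> (?C - A)"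
          using m L e by (simp add: ennreal_plus ennreal_add_left_cancel_le)
        then have "ennreal (L * e) / ennreal e \<le> emeasure \<mu> (?C - A) / ennreal e"
          by (rule divide_right_mono_ennreal)
        then show ?thesis unfolding L_def[symmetric] using e L by (simp add: divide_ennreal)
      qed
      then show "\<forall>\<^sub>F e in at_right 0. ennreal (s * c powr q * m powr (1 - q)) \<le> emeasure \<mu> (A + (*\<^sub>R) e ` K - A) / ennreal e"
        by (auto simp: eventually_at_right_less intro: eventually_mono[OF eventually_at_right_less])
    qed
    have bd: "isoperimetric_bound \<mu> K q A = ennreal s * ennreal_powr (emeasure \<mu> K) q * ennreal (m powr (1 - q))"
      using False m by (simp add: isoperimetric_bound_def s_def ennreal_powr_def)
    show ?thesis
    proof (cases "emeasure \<mu> K")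
      case (real k)
      show ?thesis
      proof (cases "k = 0")
        case True
        then show ?thesis using real assms(2) by (simp add: bd ennreal_powr_def)
      next
        case False
        then have "ennreal (s * k powr q * m powr (1 - q)) \<le> outer_boundary_measure \<mu> K A"
          using real by (intro bound) auto
        then show ?thesis using real s by (simp add: bd ennreal_powr_def ennreal_mult')
      qed
    next
      case top
      have "outer_boundary_measure \<mu> K A = top"
      proof (cases "outer_boundary_measure \<mu> K A")
        case (real B)
        \<comment> \<open>Chosen so that the lower bound equals \<open>B + 1\<close>, which
          contradicts a finite boundary measure \<open>B\<close>.\<close>
        define c where "c = ((B + 1) / (s * m powr (1 - q))) powr s"
        have D: "0 < s * m powr (1 - q)" using s m by simp
        then have "0 < c" using real s m by (simp add: c_def)
        then have "ennreal (s * c powr q * m powr (1 - q)) \<le> ennreal B"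
          using bound[of c] top real by simp
        moreover have "s * c powr q * m powr (1 - q) = B + 1"
        proof -
          have "c powr q = (B + 1) / (s * m powr (1 - q))"
            using real D s by (simp add: c_def sq powr_powr)
          then show ?thesis using s m by (simp add: field_simps)
        qed
        ultimately show ?thesis using real by simp
      qed
      then show ?thesis by simp
    qed
  qed (simp add: isoperimetric_bound_def)

  have eq: "outer_boundary_measure \<mu> K ((*\<^sub>R) t ` K) = isoperimetric_bound \<mu> K q ((*\<^sub>R) t ` K)"
    if t: "0 < t" and fin: "emeasure \<mu> ((*\<^sub>R) t ` K) < \<infinity>" for t
  proof -
    \<comment> \<open>The measure of \<open>tK\<close> is a positive multiple of that of
      \<open>K\<close>, so its finiteness passes to \<open>K\<close>.\<close>
    obtain k where k: "emeasure \<mu> K = ennreal k" "0 \<le> k"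
      using fin t scK[OF t] by (cases "emeasure \<mu> K") (auto simp: ennreal_mult_top)
    \<comment> \<open>Since \<open>tK + eK = (t + e)K\<close>, the quotient is exactly
      \<open>k\<close> times a difference quotient of \<open>z powr s\<close> at \<open>t\<close>;
      its limit is a derivative.\<close>
    have quot: "emeasure \<mu> ((*\<^sub>R) t ` K + (*\<^sub>R) e ` K - (*\<^sub>R) t ` K) / ennreal e =
        ennreal (((t + e) powr s - t powr s) / e * k)" if e: "0 < e" for e
    proof -
      have "(*\<^sub>R) t ` K \<subseteq> (*\<^sub>R) t ` K + (*\<^sub>R) e ` K" using K(2) by (force simp: set_plus_def)
      then have "emeasure \<mu> ((*\<^sub>R) t ` K + (*\<^sub>R) e ` K - (*\<^sub>R) t ` K) =
          emeasure \<mu> ((*\<^sub>R) (t + e) ` K) - emeasure \<mu> ((*\<^sub>R) t ` K)"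
        unfolding Kadd[OF t e]
        using fin openK[OF t] openK[of "t + e"] t e by (intro emeasure_Diff) (auto intro!: sets_\<mu>)
      also have "\<dots> = ennreal ((t + e) powr s * k - t powr s * k)"
        using t e k by (simp add: scK ennreal_mult'[symmetric] ennreal_minus)
      moreover have "t powr s * k \<le> (t + e) powr s * k"
        using t e s k by (intro mult_right_mono powr_mono2) auto
      ultimately show ?thesis
        using e by (simp add: divide_ennreal algebra_simps diff_divide_distrib)
    qed
    have "((\<lambda>z. z powr s) has_real_derivative s * t powr (s - 1)) (at t)"
      using t by (auto intro!: derivative_eq_intros simp: powr_diff)
    then have "((\<lambda>e. ((t + e) powr s - t powr s) / e) \<longlongrightarrow> s * t powr (s - 1)) (at_right 0)"
      unfolding DERIV_def by (rule filterlim_mono) (auto simp: at_le)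
    then have "((\<lambda>e. ennreal (((t + e) powr s - t powr s) / e * k)) \<longlongrightarrow> ennreal (s * t powr (s - 1) * k)) (at_right 0)"
      by (intro tendsto_ennrealI tendsto_mult_right)
    then have "((\<lambda>e. emeasure \<mu> ((*\<^sub>R) t ` K + (*\<^sub>R) e ` K - (*\<^sub>R) t ` K) / ennreal e) \<longlongrightarrow>
        ennreal (s * t powr (s - 1) * k)) (at_right 0)"
      by (rule Lim_transform_eventually)
         (use quot in \<open>auto intro: eventually_mono[OF eventually_at_right_less]\<close>)
    then have "outer_boundary_measure \<mu> K ((*\<^sub>R) t ` K) = ennreal (s * t powr (s - 1) * k)"
      unfolding outer_boundary_measure_def by (intro lim_imp_Liminf) auto
    also have "\<dots> = isoperimetric_bound \<mu> K q ((*\<^sub>R) t ` K)"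
    proof (cases "k = 0")
      case True
      then show ?thesis using scK[OF t] k by (simp add: isoperimetric_bound_def)
    next
      case False
      then have k0: "0 < k" using k by simp
      define M where "M = t powr s * k"
      have M: "0 < M" using t k0 by (simp add: M_def)
      have tK: "emeasure \<mu> ((*\<^sub>R) t ` K) = ennreal M"
        using scK[OF t] k by (simp add: M_def ennreal_mult')
      \<comment> \<open>Because \<open>s * (1 - q) = s - 1\<close>, the power of \<open>t\<close> in
        the derivative is the one in \<open>M powr (1 - q)\<close>; the factor \<open>k\<close>
        splits into its powers \<open>q\<close> and \<open>1 - q\<close>.\<close>
      have "t powr (s - 1) = (t powr s) powr (1 - q)"
        using t s by (simp add: sq powr_powr right_diff_distrib)
      moreover have "k = k powr q * k powr (1 - q)" using k0 by (simp add: powr_add[symmetric])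
      ultimately have "s * t powr (s - 1) * k = s * k powr q * M powr (1 - q)"
        using k0 by (simp add: M_def powr_mult)
      moreover have "isoperimetric_bound \<mu> K q ((*\<^sub>R) t ` K) = ennreal (s * k powr q * M powr (1 - q))"
        using M s k unfolding isoperimetric_bound_def tK
        by (simp add: ennreal_powr_def ennreal_mult' s_def[symmetric])
      ultimately show ?thesis by (simp only:)
    qed
    finally show ?thesis .
  qed
  \<comment> \<open>The bound depends on a set only through its measure, so the value attained at
    \<open>tK\<close> is the lower bound for every competitor.\<close>
  have "isoperimetric_minimizer \<mu> K ((*\<^sub>R) t ` K)"
    if t: "0 < t" and fin: "emeasure \<mu> ((*\<^sub>R) t ` K) < \<infinity>" for t
    unfolding isoperimetric_minimizer_def eq[OF t fin]
  proof (intro ballI impI)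
    fix B assume B: "B \<in> sets borel" "emeasure \<mu> B = emeasure \<mu> ((*\<^sub>R) t ` K)"
    then have "isoperimetric_bound \<mu> K q ((*\<^sub>R) t ` K) = isoperimetric_bound \<mu> K q B"
      by (simp add: isoperimetric_bound_def)
    then show "isoperimetric_bound \<mu> K q ((*\<^sub>R) t ` K) \<le> outer_boundary_measure \<mu> K B"
      using lower[of B] B fin by simp
  qed
  with lower eq show ?thesis by blast
qed

end
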